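(* Let $a \neq b$ be two distinct symbols and let $G=(V,E)$ be a graph. The following statements are equivalent. (i) $G$ is bipartite. (ii) $G$ admits a uniform directional labeling of its edges by the ordered pairs $ab$ and $ba$.
   Context: Graphs are simple and undirected. A graph $G=(V,E)$ is bipartite if $V$ can be partitioned into two (possibly empty) sets $V_1$ and $V_2$ such that every edge of $G$ joins a vertex of $V_1$ and a vertex of $V_2$. Fix distinct symbols $a,b$. A directional labeling of the edges of $G$ by the ordered pairs $ab$ and $ba$ assigns to each edge $uv$, in each of its two directions, a label in $\{ab,ba\}$, written $\ell(uv)$ for the direction from $u$ to $v$ and $\ell(vu)$ for the direction from $v$ to $u$, such that $\ell(uv)=ab$ if and only if $\ell(vu)=ba$ (so exactly one of $\ell(uv),\ell(vu)$ is $ab$ and the other is $ba$). For a vertex $u$ with at least one incident edge, write $\ell_e(u)=ab$ if $\ell(uu')=ab$ for every neighbor $u'$ of $u$, and $\ell_e(u)=ba$ if $\ell(uu')=ba$ for every neighbor $u'$ of $u$. In either case the labeling is called directionally uniform at $u$. $G$ admits a uniform directional labeling of its edges by $ab$ and $ba$ if there is a directional labeling of its edges by $ab$ and $ba$ that is directionally uniform at every vertex having at least one incident edge, and such that for any two adjacent vertices $v_1,v_2$ one has $\ell_e(v_1)=ab \iff \ell_e(v_2)=ba$. *)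

theory Defs
  imports Main
begin

text \<open>Vertex sets may be infinite and may be empty.\<close>

definition simple_graph :: "'v set \<Rightarrow> 'v set set \<Rightarrow> bool" where
  "simple_graph V E \<longleftrightarrow> (\<forall>e\<in>E. e \<subseteq> V \<and> card e = 2)"

definition bipartite :: "'v set \<Rightarrow> 'v set set \<Rightarrow> bool" where
  "bipartite V E \<longleftrightarrow>
     (\<exists>V1 V2. V1 \<union> V2 = V \<and> V1 \<inter> V2 = {} \<and>
        (\<forall>e\<in>E. \<exists>u\<in>V1. \<exists>v\<in>V2. e = {u, v}))"

definition neighbours :: "'v set set \<Rightarrow> 'v \<Rightarrow> 'v set" where
  "neighbours E u = {u'. {u, u'} \<in> E}"

text \<open>
  A labeling is a function \<open>l\<close> on ordered pairs of vertices: \<open>l u v\<close> is the label of the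
  edge \<open>uv\<close> in the direction from \<open>u\<close> to \<open>v\<close>. Its values on non-adjacent pairs are
  irrelevant and unconstrained. The symbols \<open>ab\<close> and \<open>ba\<close> are the ordered pairs
  \<open>(a, b)\<close> and \<open>(b, a)\<close>.
\<close>

definition directional_labeling ::
    "'v set set \<Rightarrow> 's \<Rightarrow> 's \<Rightarrow> ('v \<Rightarrow> 'v \<Rightarrow> 's \<times> 's) \<Rightarrow> bool" where
  "directional_labeling E a b l \<longleftrightarrow>
     (\<forall>u v. {u, v} \<in> E \<longrightarrow>
        l u v \<in> {(a, b), (b, a)} \<and> (l u v = (a, b) \<longleftrightarrow> l v u = (b, a)))"

text \<open>
  The partial function \<open>\<ell>\<^sub>e\<close>, undefined (\<open>None\<close>) at isolated vertices and at vertices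
  where the labeling is not uniform.
\<close>

definition vertex_label ::
    "'v set set \<Rightarrow> 's \<Rightarrow> 's \<Rightarrow> ('v \<Rightarrow> 'v \<Rightarrow> 's \<times> 's) \<Rightarrow> 'v \<Rightarrow> ('s \<times> 's) option" where
  "vertex_label E a b l u =
     (if neighbours E u = {} then None
      else if \<forall>u'\<in>neighbours E u. l u u' = (a, b) then Some (a, b)
      else if \<forall>u'\<in>neighbours E u. l u u' = (b, a) then Some (b, a)
      else None)"

definition directionally_uniform_at ::
    "'v set set \<Rightarrow> 's \<Rightarrow> 's \<Rightarrow> ('v \<Rightarrow> 'v \<Rightarrow> 's \<times> 's) \<Rightarrow> 'v \<Rightarrow> bool" where
  "directionally_uniform_at E a b l u \<longleftrightarrow>
     vertex_label E a b l u = Some (a, b) \<or> vertex_label E a b l u = Some (b, a)"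

definition admits_uniform_directional_labeling ::
    "'v set \<Rightarrow> 'v set set \<Rightarrow> 's \<Rightarrow> 's \<Rightarrow> bool" where
  "admits_uniform_directional_labeling V E a b \<longleftrightarrow>
     (\<exists>l. directional_labeling E a b l \<and>
          (\<forall>u\<in>V. neighbours E u \<noteq> {} \<longrightarrow> directionally_uniform_at E a b l u) \<and>
          (\<forall>v1 v2. {v1, v2} \<in> E \<longrightarrow>
             (vertex_label E a b l v1 = Some (a, b) \<longleftrightarrow> vertex_label E a b l v2 = Some (b, a))))"

end

theory Submission
  imports Defs
begin

text \<open>
  A labeling that is uniform at a vertex \<open>u\<close> does not depend on the other endpoint of an edge at
  \<open>u\<close>, so a uniform labeling is the same thing as a 2-colouring of the non-isolated vertices
  with colours \<open>(a, b)\<close> and \<open>(b, a)\<close>; the compatibility condition along edges says that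
  this colouring is proper. Given a bipartition, every direction is labeled according to the side
  of its starting point (lemma \<open>vertex_label_of_source\<close> recovers the colour). Conversely, the
  vertices with label \<open>(a, b)\<close> form one side and all other vertices the second one; isolated
  vertices carry no label, and land on the second side, where they do no harm.
\<close>

lemma vertex_label_of_source:
  assumes "\<And>v. l u v = c" and "c \<in> {(a, b), (b, a)}" and "{u, u'} \<in> E"
  shows "vertex_label E a b l u = Some c"
proof -
  have "u' \<in> neighbours E u"
    using assms(3) by (simp add: neighbours_def)
  then show ?thesis
    using assms(1,2) by (auto simp: vertex_label_def)
qed

lemma bipartite_imp_admits_uniform_directional_labeling:
  assumes "a \<noteq> b" and "bipartite V E"
  shows "admits_uniform_directional_labeling V E a b"
proof -
  obtain V1 V2 where disj: "V1 \<inter> V2 = {}"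
    and edges: "\<forall>e\<in>E. \<exists>u\<in>V1. \<exists>v\<in>V2. e = {u, v}"
    using assms(2) unfolding bipartite_def by blast
  define colour where "colour u = (if u \<in> V1 then (a, b) else (b, a))" for u
  have opposite: "u \<in> V1 \<longleftrightarrow> v \<notin> V1" if "{u, v} \<in> E" for u v
    using edges disj that by (fastforce simp: doubleton_eq_iff)
  have label: "vertex_label E a b (\<lambda>u v. colour u) u = Some (colour u)" if "{u, v} \<in> E" for u v
    using that by (intro vertex_label_of_source) (auto simp: colour_def)
  have "directional_labeling E a b (\<lambda>u v. colour u)"
    using opposite assms(1) by (auto simp: directional_labeling_def colour_def)
  moreover have "directionally_uniform_at E a b (\<lambda>u v. colour u) u"
    if nonisolated: "neighbours E u \<noteq> {}" for u
  proof -
    obtain v where "{u, v} \<in> E"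
      using nonisolated by (auto simp: neighbours_def)
    then show ?thesis
      using label by (simp add: directionally_uniform_at_def colour_def)
  qed
  moreover have "vertex_label E a b (\<lambda>u v. colour u) u = Some (a, b) \<longleftrightarrow>
      vertex_label E a b (\<lambda>u v. colour u) v = Some (b, a)" if uv: "{u, v} \<in> E" for u v
  proof -
    have "{v, u} \<in> E"
      using uv by (simp add: insert_commute)
    then show ?thesis
      using label[OF uv] label[of v u] opposite[OF uv] assms(1) by (simp add: colour_def)
  qed
  ultimately show ?thesis
    unfolding admits_uniform_directional_labeling_def by blast
qed

lemma admits_uniform_directional_labeling_imp_bipartite:
  assumes "a \<noteq> b" and "simple_graph V E"
    and "admits_uniform_directional_labeling V E a b"
  shows "bipartite V E"
proof -
  obtain l where uniform: "\<And>u. u \<in> V \<Longrightarrow> neighbours E u \<noteq> {} \<Longrightarrow> directionally_uniform_at E a b l u"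
    and alternate: "\<And>u v. {u, v} \<in> E \<Longrightarrow>
      vertex_label E a b l u = Some (a, b) \<longleftrightarrow> vertex_label E a b l v = Some (b, a)"
    using assms(3) unfolding admits_uniform_directional_labeling_def by blast
  define V1 where "V1 = {u \<in> V. vertex_label E a b l u = Some (a, b)}"
  have "\<exists>u\<in>V1. \<exists>v\<in>V - V1. e = {u, v}" if e: "e \<in> E" for e
  proof -
    obtain x y where xy: "e = {x, y}" "x \<in> V" "y \<in> V"
      using assms(2) e unfolding simple_graph_def by (metis card_2_iff insert_subset)
    have edges: "{x, y} \<in> E" "{y, x} \<in> E"
      using e xy(1) by (simp_all add: insert_commute)
    have "neighbours E x \<noteq> {}"
      using edges(1) by (auto simp: neighbours_def)
    then have "directionally_uniform_at E a b l x"
      using uniform xy(2) by blast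
    then consider (ab) "vertex_label E a b l x = Some (a, b)"
      | (ba) "vertex_label E a b l x = Some (b, a)"
      unfolding directionally_uniform_at_def by blast
    then show ?thesis
    proof cases
      case ab
      then have "vertex_label E a b l y = Some (b, a)"
        using alternate[OF edges(1)] by simp
      then have "x \<in> V1" "y \<in> V - V1"
        using ab xy(2,3) assms(1) by (auto simp: V1_def)
      then show ?thesis
        using xy(1) by blast
    next
      case ba
      \<comment> \<open>The condition along edges mentions only one of the two ways to alternate; the other one
        comes from reading the edge backwards.\<close>
      then have "vertex_label E a b l y = Some (a, b)"
        using alternate[OF edges(2)] by simp
      then have "y \<in> V1" "x \<in> V - V1"
        using ba xy(2,3) assms(1) by (auto simp: V1_def)
      then show ?thesis
        using xy(1) by blast
    qed
  qed
  moreover have "V1 \<union> (V - V1) = V" "V1 \<inter> (V - V1) = {}"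
    by (auto simp: V1_def)
  ultimately show ?thesis
    unfolding bipartite_def by blast
qed

theorem theorem1:
  fixes a b :: 's and V :: "'v set" and E :: "'v set set"
  assumes "a \<noteq> b"
    and "simple_graph V E"
  shows "bipartite V E \<longleftrightarrow> admits_uniform_directional_labeling V E a b"
  using assms bipartite_imp_admits_uniform_directional_labeling
    admits_uniform_directional_labeling_imp_bipartite by metis

end
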